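(* Let $\mathcal{L} \subseteq \mathbb{S}^n$ be a linear subspace, let $C, Y \in \mathbb{S}^n$, and let $\mathcal{S} \subseteq \mathbb{S}^n$ be a subspace whose orthogonal projection $P_{\mathcal{S}} : \mathbb{S}^n \to \mathbb{S}^n$ satisfies the Constraint Set Invariance Conditions for $(C, Y, \mathcal{L})$. For an inner-product space $\mathcal{V}$, let $\Psi : \mathcal{V} \to \mathbb{S}^n$ be an injective linear map with range equal to $\mathcal{S}$ and let $\mathcal{C} \subseteq \mathcal{V}$ be a self-dual cone that satisfies $\Psi(\mathcal{C}) = \mathbb{S}^n_{+}\cap\mathcal{S}$. If $\hat X \in \mathcal{V}$ and $\hat S \in \mathcal{V}$ solve (i.e., are respectively primal optimal and dual optimal for) the primal-dual pair of conic optimization problems $$\text{minimize } \langle \Psi^*(C), \hat X\rangle \ \text{ subject to } \hat X \in (\Psi^*\Psi)^{-1}\Psi^*(Y+\mathcal{L}),\ \hat X\in\mathcal{C},$$ $$\text{maximize } -\langle (\Psi^*\Psi)^{-1}\Psi^*(Y), \hat S\rangle \ \text{ subject to } \hat S \in \Psi^*(C+\mathcal{L}^{\perp}),\ \hat S\in\mathcal{C},$$ then $\Psi(\hat X)$ and $\Psi(\Psi^*\Psi)^{-1}(\hat S)$ solve the primal-dual pair $$\text{minimize } P_{\mathcal{S}}(C)\cdot X \ \text{ subject to } X \in P_{\mathcal{S}}(Y) + \mathcal{L}\cap\mathcal{S},\ X \in \mathbb{S}^n_{+}\cap\mathcal{S},$$ $$\text{maximize } -P_{\mathcal{S}}(Y)\cdot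 S \ \text{ subject to } S \in P_{\mathcal{S}}(C) + \mathcal{L}^{\perp}\cap\mathcal{S},\ S \in \mathbb{S}^n_{+}\cap\mathcal{S},$$ and hence they also solve the primal-dual pair $$\text{minimize } C\cdot X \ \text{ subject to } X \in Y+\mathcal{L},\ X\in\mathbb{S}^n_{+}, \qquad \text{maximize } -Y\cdot S \ \text{ subject to } S\in C+\mathcal{L}^{\perp},\ S\in\mathbb{S}^n_{+}.$$
   Context: $\mathbb{S}^n$ is the space of real symmetric $n\times n$ matrices with the trace inner product $X\cdot Y := \mathrm{Tr}(XY)$; $\mathbb{S}^n_+$ is the positive semidefinite cone; $P_{\mathcal{S}}$ is the orthogonal projection onto $\mathcal{S}$. $\Psi^*:\mathbb{S}^n\to\mathcal{V}$ is the adjoint of $\Psi$. A cone $\mathcal{C}\subseteq\mathcal{V}$ is self-dual if $\mathcal{C} = \{v\in\mathcal{V}: \langle v,c\rangle\ge0\ \forall c\in\mathcal{C}\}$. Constraint Set Invariance Conditions: $P_{\mathcal{S}}$ satisfies them if (a) $P_{\mathcal{S}}(\mathbb{S}^n_+)\subseteq \mathbb{S}^n_+$; (b) $P_{\mathcal{S}}(Y+\mathcal{L})\subseteq Y+\mathcal{L}$; (c) $P_{\mathcal{S}}(C+\mathcal{L}^\perp)\subseteq C+\mathcal{L}^\perp$. *)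

theory Defs
  imports "HOL-Analysis.Analysis"
begin

definition symmat :: "(real^'n^'n) set" where
  "symmat = {X. transpose X = X}"

definition psd :: "(real^'n^'n) set" where
  "psd = {X \<in> symmat. \<forall>x. 0 \<le> x \<bullet> (X *v x)}"

definition trace_inner :: "real^'n^'n \<Rightarrow> real^'n^'n \<Rightarrow> real"  (infixl "\<odot>" 70) where
  "X \<odot> Y = trace (X ** Y)"

text \<open>On symmetric matrices the trace inner product is the library's inner product on
  \<^typ>\<open>real^'n^'n\<close>.  Hence, for a linear map \<open>\<Psi>\<close> with values in \<^const>\<open>symmat\<close>, the restriction of
  \<open>adjoint \<Psi>\<close> to \<^const>\<open>symmat\<close> is the adjoint of \<open>\<Psi>\<close> with respect to the trace inner product.\<close>

lemma trace_inner_eq_inner: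
  fixes X Y :: "real^'n^'n"
  assumes "X \<in> symmat"
  shows "X \<odot> Y = X \<bullet> Y"
proof -
  have sym: "X $ i $ j = X $ j $ i" for i j
    using assms by (simp add: symmat_def transpose_def vec_eq_iff)
  have "X \<odot> Y = (\<Sum>i\<in>UNIV. \<Sum>k\<in>UNIV. X $ k $ i * Y $ k $ i)"
    unfolding trace_inner_def trace_def matrix_matrix_mult_def by (simp add: sym)
  also have "\<dots> = X \<bullet> Y"
    by (subst sum.swap) (simp add: inner_vec_def)
  finally show ?thesis .
qed

text \<open>The orthogonal complement is taken inside \<^const>\<open>symmat\<close>; the library's
  \<^const>\<open>orthogonal_comp\<close> would also contain all skew-symmetric matrices.\<close>

definition sym_perp :: "(real^'n^'n) set \<Rightarrow> (real^'n^'n) set" where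
  "sym_perp L = {Z \<in> symmat. \<forall>X\<in>L. Z \<odot> X = 0}"

definition orth_proj :: "(real^'n^'n) set \<Rightarrow> real^'n^'n \<Rightarrow> real^'n^'n" where
  "orth_proj S X = (THE P. P \<in> S \<and> (\<forall>Z\<in>S. (X - P) \<odot> Z = 0))"

lemma orth_proj_iff:
  fixes S :: "(real^'n^'n) set"
  assumes "subspace S" and "S \<subseteq> symmat" and "X \<in> symmat"
  shows "orth_proj S X = P \<longleftrightarrow> P \<in> S \<and> (\<forall>Z\<in>S. (X - P) \<odot> Z = 0)"
proof -
  have eq: "(X - Q) \<odot> Z = (X - Q) \<bullet> Z" if "Q \<in> S" for Q Z
  proof (rule trace_inner_eq_inner)
    show "X - Q \<in> symmat"
      using assms that by (auto simp: symmat_def transpose_def vec_eq_iff subset_iff)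
  qed
  obtain Q R where Q: "Q \<in> span S" and R: "\<And>w. w \<in> span S \<Longrightarrow> orthogonal R w"
    and X: "X = Q + R"
    using orthogonal_subspace_decomp_exists[of S X] by blast
  have Q': "Q \<in> S \<and> (\<forall>Z\<in>S. (X - Q) \<odot> Z = 0)"
  proof -
    have span: "span S = S" using assms(1) by (simp add: span_eq_iff)
    have QS: "Q \<in> S" using Q unfolding span .
    have "(X - Q) \<odot> Z = 0" if "Z \<in> S" for Z
    proof -
      have "(X - Q) \<odot> Z = R \<bullet> Z" using eq[OF QS] X by simp
      also have "\<dots> = 0" using R[of Z] that by (simp add: span orthogonal_def)
      finally show ?thesis .
    qed
    with QS show ?thesis by blast
  qed
  have uniq: "P1 = P2"
    if "P1 \<in> S \<and> (\<forall>Z\<in>S. (X - P1) \<odot> Z = 0)" "P2 \<in> S \<and> (\<forall>Z\<in>S. (X - P2) \<odot> Z = 0)" for P1 P2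
  proof -
    have D: "P1 - P2 \<in> S" using that assms(1) by (simp add: subspace_diff)
    have "(X - P1) \<bullet> (P1 - P2) = 0" "(X - P2) \<bullet> (P1 - P2) = 0"
      using that D eq by auto
    then have "(P1 - P2) \<bullet> (P1 - P2) = 0" by (simp add: inner_diff_left)
    then show ?thesis by simp
  qed
  have "orth_proj S X = Q"
    unfolding orth_proj_def using Q' uniq by (intro the_equality) blast+
  then show ?thesis using Q' uniq by blast
qed

text \<open>The space \<open>\<V>\<close> is an arbitrary \<^class>\<open>real_inner\<close> type, so that the zero space is included.
  The library constant \<^const>\<open>adjoint\<close> is defined by a choice operator; the following lemma shows that
  it is the adjoint also in this generality, since \<open>\<Psi>\<close> is injective.\<close>

lemma adjoint_inj_works:
  fixes \<Psi> :: "'v::real_inner \<Rightarrow> 'm::euclidean_space"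
  assumes lin: "linear \<Psi>" and inj: "inj \<Psi>"
  shows "\<Psi> v \<bullet> X = v \<bullet> adjoint \<Psi> X"
proof -
  obtain g where g: "linear g" "g \<circ> \<Psi> = id"
    using linear_injective_left_inverse[OF lin inj] by blast
  have "u \<in> span (g ` Basis)" for u
  proof -
    have "g (\<Psi> u) \<in> g ` span Basis" by simp
    then show ?thesis
      using g by (simp add: linear_span_image[OF g(1)] fun_eq_iff del: span_Basis)
  qed
  then obtain B where B: "finite B" "span B = (UNIV :: 'v set)" "pairwise orthogonal B"
    using basis_orthogonal[of "g ` Basis"] by (metis UNIV_eq_I finite_Basis finite_imageI)
  define f where "f Z = (\<Sum>b\<in>B. ((\<Psi> b \<bullet> Z) / (b \<bullet> b)) *\<^sub>R b)" for Z
  have on_B: "c \<bullet> f Z = \<Psi> c \<bullet> Z" if "c \<in> B" for c Z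
  proof -
    have "c \<bullet> f Z = (\<Sum>b\<in>B. (\<Psi> b \<bullet> Z) / (b \<bullet> b) * (c \<bullet> b))"
      by (simp add: f_def inner_sum_right)
    also have "\<dots> = (\<Sum>b\<in>B. if b = c then \<Psi> c \<bullet> Z else 0)"
    proof (rule sum.cong[OF refl])
      fix b assume "b \<in> B"
      then have "b \<noteq> c \<Longrightarrow> c \<bullet> b = 0"
        using B(3) that by (auto simp: pairwise_def orthogonal_def)
      then show "(\<Psi> b \<bullet> Z) / (b \<bullet> b) * (c \<bullet> b) = (if b = c then \<Psi> c \<bullet> Z else 0)"
        by (cases "c = 0") (auto simp: linear_0[OF lin])
    qed
    also have "\<dots> = \<Psi> c \<bullet> Z" using B(1) that by simp
    finally show ?thesis .
  qed
  have "\<Psi> u \<bullet> Z = u \<bullet> f Z" for u Z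
  proof -
    have "u \<in> span B" by (simp add: B(2))
    then show ?thesis
    proof (induction rule: span_induct_alt)
      case base
      show ?case by (simp add: linear_0[OF lin])
    next
      case (step c x y)
      then show ?case
        by (simp add: linear_add[OF lin] linear_scale[OF lin] inner_add_left on_B)
    qed
  qed
  then have "\<exists>f'. \<forall>x y. \<Psi> x \<bullet> y = x \<bullet> f' y" by blast
  then show ?thesis
    unfolding adjoint_def by (rule someI2_ex) blast
qed

definition constraint_set_invariance ::
  "(real^'n^'n \<Rightarrow> real^'n^'n) \<Rightarrow> real^'n^'n \<Rightarrow> real^'n^'n \<Rightarrow> (real^'n^'n) set \<Rightarrow> bool" where
  "constraint_set_invariance P C Y L \<longleftrightarrow>
     P ` psd \<subseteq> psd \<and>
     P ` ((+) Y ` L) \<subseteq> (+) Y ` L \<and>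
     P ` ((+) C ` sym_perp L) \<subseteq> (+) C ` sym_perp L"

definition self_dual_cone :: "('v::real_inner) set \<Rightarrow> bool" where
  "self_dual_cone K \<longleftrightarrow> cone K \<and> K = {v. \<forall>c\<in>K. 0 \<le> v \<bullet> c}"

end

theory Submission
  imports Defs
begin

text \<open>Let \<open>A\<close> be the adjoint of \<open>\<Psi>\<close> and \<open>P\<close> the projection onto \<open>S = range \<Psi>\<close>.  Since
  \<open>A X = A (P X)\<close>, the vector \<open>(A \<Psi>)\<inverse> (A X)\<close> is the \<open>\<Psi>\<close>-preimage of \<open>P X\<close>, which identifies the feasible
  sets and objectives over \<open>\<V>\<close> with those over \<open>S\<close>.  On the dual side this also requires that
  \<open>A (\<Psi> w)\<close> lies in the cone iff \<open>\<Psi> w\<close> is positive semidefinite, which follows from self-duality of both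
  cones and invariance of the semidefinite cone under \<open>P\<close>.  Finally, \<open>P\<close> maps a feasible point \<open>X\<close> of the
  original problem to a feasible point with the same objective value, because
  \<open>C \<bullet> (X - P X) = (C - P C) \<bullet> (X - P X)\<close> with \<open>C - P C \<in> L\<^sup>\<bottom>\<close> and \<open>X - P X \<in> L\<close>.\<close>

section \<open>Symmetric matrices and self-duality of the semidefinite cone\<close>

lemma subspace_symmat: "subspace (symmat :: (real^'n^'n) set)"
  by (auto simp: subspace_def symmat_def transpose_def vec_eq_iff)

lemma subspace_sym_perp: "subspace (sym_perp L)"
proof -
  have "sym_perp L = symmat \<inter> {Z. \<forall>X\<in>L. Z \<bullet> X = 0}"
    by (auto simp: sym_perp_def trace_inner_eq_inner)
  moreover have "subspace {Z. \<forall>X\<in>L. Z \<bullet> X = 0}"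
    by (auto simp: subspace_def inner_add_left)
  ultimately show ?thesis
    by (simp add: subspace_inter subspace_symmat)
qed

lemma psd_subset_symmat: "psd \<subseteq> symmat"
  by (auto simp: psd_def)

lemma inner_matrix_symmat: "X \<in> symmat \<Longrightarrow> (X *v y) \<bullet> x = y \<bullet> (X *v x)"
  by (metis (mono_tags, lifting) dot_lmul_matrix mem_Collect_eq symmat_def transpose_matrix_vector)

text \<open>The quadratic form of \<open>X\<close> is nonnegative at every combination
  \<open>s x + t y\<close>, and suitable \<open>s\<close>, \<open>t\<close> give the inequality.
  Since the form may be degenerate, \<open>c = 0\<close> is a separate case.\<close>

lemma psd_cauchy_schwarz:
  fixes X :: "real^'n^'n"
  assumes X: "X \<in> psd"
  shows "(x \<bullet> (X *v y))\<^sup>2 \<le> (x \<bullet> (X *v x)) * (y \<bullet> (X *v y))"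
proof -
  have sym: "y \<bullet> (X *v x) = x \<bullet> (X *v y)" for x y
    using inner_matrix_symmat[of X y x] X by (simp add: psd_def inner_commute)
  define a b c where abc: "a = x \<bullet> (X *v x)" "b = x \<bullet> (X *v y)" "c = y \<bullet> (X *v y)"
  have nonneg: "0 \<le> a * s\<^sup>2 + 2 * b * s * t + c * t\<^sup>2" for s t
  proof -
    have "(s *\<^sub>R x + t *\<^sub>R y) \<bullet> (X *v (s *\<^sub>R x + t *\<^sub>R y)) = a * s\<^sup>2 + 2 * b * s * t + c * t\<^sup>2"
      using sym[of y x]
      by (simp add: abc matrix_vector_right_distrib matrix_vector_mult_scaleR
          inner_add_left inner_add_right power2_eq_square algebra_simps)
    moreover have "0 \<le> (s *\<^sub>R x + t *\<^sub>R y) \<bullet> (X *v (s *\<^sub>R x + t *\<^sub>R y))"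
      using X unfolding psd_def by blast
    ultimately show ?thesis by simp
  qed
  have c0: "0 \<le> c" and a0: "0 \<le> a" using nonneg[of 0 1] nonneg[of 1 0] by auto
  have "b\<^sup>2 \<le> a * c"
  proof (cases "c = 0")
    case True
    \<comment> \<open>With \<open>c = 0\<close> the form is \<open>a s^2 + 2 b s t\<close>; at
      \<open>s = b\<close>, \<open>t = -(a + 1)\<close> it equals \<open>-b^2 (a + 2)\<close>, which
      forces \<open>b = 0\<close>.\<close>
    then have "0 \<le> a * b\<^sup>2 - 2 * b\<^sup>2 * (a + 1)"
      using nonneg[of b "- (a + 1)"] by (simp add: power2_eq_square algebra_simps)
    then have "b\<^sup>2 * (a + 2) \<le> 0" by (simp add: algebra_simps)
    then have "b\<^sup>2 \<le> 0" using a0 by (simp add: mult_le_0_iff)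
    then show ?thesis by (simp add: True)
  next
    case False
    \<comment> \<open>For \<open>s = c > 0\<close> the form is minimal at
      \<open>t = -b\<close>.\<close>
    have "0 \<le> a * c\<^sup>2 + 2 * b * c * (- b) + c * (- b)\<^sup>2" by (rule nonneg)
    also have "\<dots> = c * (a * c - b\<^sup>2)" by (simp add: power2_eq_square algebra_simps)
    finally show ?thesis using c0 False by (simp add: zero_le_mult_iff)
  qed
  then show ?thesis by (simp add: abc)
qed

text \<open>This is \<open>v v^T\<close>. It serves as the pivot term in the elimination and as a
  test matrix whose inner product with \<open>Y\<close> is the quadratic form of \<open>Y\<close> at
  \<open>v\<close>.\<close>

definition rank_one :: "real^'n \<Rightarrow> real^'n^'n" where
  "rank_one v = (\<chi> i j. v $ i * v $ j)"

lemma rank_one_mult: "rank_one v *v x = (v \<bullet> x) *\<^sub>R v"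
  by (simp add: rank_one_def matrix_vector_mult_def inner_vec_def vec_eq_iff sum_distrib_left
      mult_ac)

lemma rank_one_symmat: "rank_one v \<in> symmat"
  by (simp add: rank_one_def symmat_def transpose_def vec_eq_iff mult.commute)

lemma rank_one_psd: "rank_one v \<in> psd"
  by (simp add: psd_def rank_one_symmat rank_one_mult inner_commute)

lemma inner_rank_one: "rank_one v \<bullet> Y = v \<bullet> (Y *v v)"
  by (simp add: rank_one_def inner_vec_def matrix_vector_mult_def sum_distrib_left mult_ac)

text \<open>Symmetric elimination: while some diagonal entry \<open>X\<^sub>i\<^sub>i\<close> is positive, subtracting the rank-one
  matrix built from the \<open>i\<close>-th column keeps \<open>X\<close> positive semidefinite, creates a zero at position \<open>i\<close> of
  the diagonal and preserves the zeros already there.\<close>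
lemma psd_inner_nonneg:
  fixes X Y :: "real^'n^'n"
  assumes "X \<in> psd" and Y: "Y \<in> psd"
  shows "0 \<le> X \<bullet> Y"
  using assms(1)
proof (induction "card {i. X $ i $ i \<noteq> 0}" arbitrary: X rule: less_induct)
  case less
  note X = less.prems
  have ax: "axis i 1 \<bullet> (Z *v axis j 1) = Z $ i $ j" for i j and Z :: "real^'n^'n"
    by (simp add: matrix_vector_mult_basis inner_axis' column_def)
  have diag: "0 \<le> Z $ i $ i" if "Z \<in> psd" for i and Z :: "real^'n^'n"
    using that ax[of i Z i] unfolding psd_def by (metis (mono_tags, lifting) mem_Collect_eq)
  show ?case
  proof (cases "\<exists>i. X $ i $ i \<noteq> 0")
    case False
    \<comment> \<open>Once the diagonal is zero, Cauchy-Schwarz on basis vectors kills every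
      entry.\<close>
    have "(X $ i $ j)\<^sup>2 \<le> 0" for i j
      using psd_cauchy_schwarz[OF X, of "axis i 1" "axis j 1"] False by (simp add: ax)
    then have "X = 0" by (simp add: vec_eq_iff)
    then show ?thesis by simp
  next
    case True
    then obtain i where i: "X $ i $ i \<noteq> 0" by blast
    define u where "u = X *v axis i 1"
    define p where "p = X $ i $ i"
    define X' where "X' = X - (1 / p) *\<^sub>R rank_one u"
    have p: "0 < p" using i diag[OF X, of i] by (simp add: p_def)
    have X'mult: "X' *v x = X *v x - ((u \<bullet> x) / p) *\<^sub>R u" for x
      by (simp add: X'_def matrix_vector_mult_diff_rdistrib rank_one_mult
          scaleR_matrix_vector_assoc[symmetric])
    have "X' \<in> symmat"
      using X psd_subset_symmat rank_one_symmat[of u] subspace_symmat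
      by (auto simp: X'_def intro!: subspace_diff subspace_scale)
    moreover have "0 \<le> x \<bullet> (X' *v x)" for x
    proof -
      have ux: "u \<bullet> x = x \<bullet> (X *v axis i 1)" by (simp add: u_def inner_commute)
      \<comment> \<open>Semidefiniteness of \<open>X'\<close> at \<open>x\<close> is exactly
        Cauchy-Schwarz for \<open>x\<close> and the \<open>i\<close>-th basis vector, at which the
        form has the value \<open>p\<close>.\<close>
      have "(u \<bullet> x)\<^sup>2 \<le> (x \<bullet> (X *v x)) * p"
        using psd_cauchy_schwarz[OF X, of x "axis i 1"] by (simp add: ux ax p_def)
      then have "(u \<bullet> x)\<^sup>2 / p \<le> x \<bullet> (X *v x)" using p by (simp add: field_simps)
      then show ?thesis
        by (simp add: X'mult inner_diff_right power2_eq_square inner_commute)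
    qed
    ultimately have X': "X' \<in> psd" by (simp add: psd_def)
    have entry: "X' $ j $ j = X $ j $ j - (u $ j)\<^sup>2 / p" for j
      by (simp add: X'_def rank_one_def power2_eq_square)
    have "X' $ i $ i = 0"
      using p by (simp add: entry u_def matrix_vector_mult_basis column_def p_def power2_eq_square)
    moreover have "X' $ j $ j = 0" if "X $ j $ j = 0" for j
    proof -
      \<comment> \<open>The subtraction can only lower a diagonal entry, and
        \<open>X' \<in> psd\<close> keeps it nonnegative, so a zero stays zero.\<close>
      have "0 \<le> (u $ j)\<^sup>2 / p" using p by simp
      then show ?thesis using diag[OF X', of j] that by (simp add: entry)
    qed
    ultimately have "{j. X' $ j $ j \<noteq> 0} \<subset> {j. X $ j $ j \<noteq> 0}"
      using i by auto
    then have "card {j. X' $ j $ j \<noteq> 0} < card {j. X $ j $ j \<noteq> 0}"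
      by (intro psubset_card_mono) simp_all
    then have "0 \<le> X' \<bullet> Y" using less.hyps X' by blast
    moreover have "0 \<le> rank_one u \<bullet> Y" using Y by (simp add: inner_rank_one psd_def)
    moreover have "X \<bullet> Y = X' \<bullet> Y + (1 / p) * (rank_one u \<bullet> Y)"
      by (simp add: X'_def inner_diff_left)
    ultimately show ?thesis using p by simp
  qed
qed

text \<open>Self-duality of the semidefinite cone: for the converse it suffices to test against the
  matrices \<open>rank_one v\<close>.\<close>

lemma psd_iff_inner_nonneg:
  fixes X :: "real^'n^'n"
  assumes "X \<in> symmat"
  shows "X \<in> psd \<longleftrightarrow> (\<forall>Y\<in>psd. 0 \<le> X \<bullet> Y)"
proof
  assume "\<forall>Y\<in>psd. 0 \<le> X \<bullet> Y"
  then have "0 \<le> v \<bullet> (X *v v)" for v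
    using rank_one_psd inner_rank_one[of v X] by (metis inner_commute)
  then show "X \<in> psd" using assms by (simp add: psd_def)
qed (use psd_inner_nonneg in blast)

section \<open>Orthogonal projection onto a subspace of symmetric matrices\<close>

context
  fixes S :: "(real^'n^'n) set"
  assumes sub: "subspace S" and sym: "S \<subseteq> symmat"
begin

text \<open>Characterizes the projection by its pairings with \<open>S\<close>, so that later
  identities reduce to membership and linearity of the inner product.\<close>

lemma orth_proj_eq_iff_inner:
  assumes X: "X \<in> symmat"
  shows "orth_proj S X = P \<longleftrightarrow> P \<in> S \<and> (\<forall>Z\<in>S. X \<bullet> Z = P \<bullet> Z)"
proof -
  have "(X - P) \<odot> Z = X \<bullet> Z - P \<bullet> Z" if "P \<in> S" for Z
    using that sym X subspace_diff[OF subspace_symmat, of X P]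
    by (auto simp: trace_inner_eq_inner inner_diff_left)
  then show ?thesis
    unfolding orth_proj_iff[OF sub sym X] by auto
qed

lemma orth_proj_in: "X \<in> symmat \<Longrightarrow> orth_proj S X \<in> S"
  using orth_proj_eq_iff_inner by blast

lemma orth_proj_inner: "X \<in> symmat \<Longrightarrow> Z \<in> S \<Longrightarrow> orth_proj S X \<bullet> Z = X \<bullet> Z"
  using orth_proj_eq_iff_inner by metis

lemma orth_proj_id: "X \<in> S \<Longrightarrow> orth_proj S X = X"
  using orth_proj_eq_iff_inner sym by blast

lemma orth_proj_add:
  assumes "X \<in> symmat" "Z \<in> symmat"
  shows "orth_proj S (X + Z) = orth_proj S X + orth_proj S Z"
  using assms orth_proj_in
  by (simp add: orth_proj_eq_iff_inner subspace_add[OF subspace_symmat] subspace_add[OF sub]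
      inner_add_left orth_proj_inner)

section \<open>Affine sets \<open>B + M\<close> preserved by the projection, covering both
  \<open>Y + L\<close> and \<open>C + sym_perp L\<close>\<close>

context
  fixes M :: "(real^'n^'n) set" and B :: "real^'n^'n"
  assumes M: "subspace M" "M \<subseteq> symmat" and B: "B \<in> symmat"
    and inv: "orth_proj S ` ((+) B ` M) \<subseteq> (+) B ` M"
begin

lemma affine_mem_iff: "X \<in> (+) B ` M \<longleftrightarrow> X - B \<in> M"
  by (force simp: image_iff algebra_simps)

lemma orth_proj_diff_mem: "X \<in> (+) B ` M \<Longrightarrow> X - orth_proj S X \<in> M"
  using inv subspace_diff[OF M(1), of "X - B" "orth_proj S X - B"]
  by (auto simp: affine_mem_iff subset_iff image_iff)

text \<open>Invariance of \<open>B + M\<close> makes the projection map \<open>M\<close> into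
  itself, and points of \<open>M \<inter> S\<close> are fixed by it.\<close>

lemma orth_proj_image_affine:
  "orth_proj S ` ((+) B ` M) = (+) (orth_proj S B) ` (M \<inter> S)"
proof (intro equalityI subsetI)
  fix X assume "X \<in> orth_proj S ` ((+) B ` M)"
  then obtain m where m: "m \<in> M" and X: "X = orth_proj S (B + m)" by blast
  have "B - orth_proj S B \<in> M"
    using subspace_0[OF M(1)] by (intro orth_proj_diff_mem) (simp add: affine_mem_iff)
  moreover have "B + m - orth_proj S (B + m) \<in> M"
    using m by (intro orth_proj_diff_mem) simp
  \<comment> \<open>The sum collapses to \<open>orth_proj S (B + m) - orth_proj S B\<close>, which
    is \<open>orth_proj S m\<close> by additivity.\<close>
  ultimately have "(B - orth_proj S B) + m - (B + m - orth_proj S (B + m)) \<in> M"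
    using m by (meson M(1) subspace_add subspace_diff)
  moreover have add: "orth_proj S (B + m) = orth_proj S B + orth_proj S m"
    using m M(2) B by (intro orth_proj_add) auto
  ultimately have "orth_proj S m \<in> M" by simp
  moreover have "orth_proj S m \<in> S" using m M(2) by (intro orth_proj_in) auto
  ultimately show "X \<in> (+) (orth_proj S B) ` (M \<inter> S)" using X add by blast
next
  fix X assume "X \<in> (+) (orth_proj S B) ` (M \<inter> S)"
  then obtain m where m: "m \<in> M" "m \<in> S" and X: "X = orth_proj S B + m" by blast
  then have "X = orth_proj S (B + m)"
    using M(2) B by (auto simp: orth_proj_add orth_proj_id)
  then show "X \<in> orth_proj S ` ((+) B ` M)" using m by blast
qed

text \<open>Projecting a feasible \<open>Z\<close> yields a feasible point of the restricted problem
  with the same cost. Here \<open>D\<close> is the cost matrix: \<open>C\<close> in the primal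
  problem, \<open>Y\<close> in the dual.\<close>

lemma restricted_arg_min_imp_arg_min:
  assumes psd: "orth_proj S ` psd \<subseteq> psd" and D: "D \<in> symmat"
    and perp: "\<And>m. m \<in> M \<Longrightarrow> (D - orth_proj S D) \<bullet> m = 0"
    and min: "is_arg_min (\<lambda>X. orth_proj S D \<odot> X)
        (\<lambda>X. X \<in> (+) (orth_proj S B) ` (M \<inter> S) \<and> X \<in> psd \<inter> S) X"
  shows "is_arg_min (\<lambda>X. D \<odot> X) (\<lambda>X. X \<in> (+) B ` M \<and> X \<in> psd) X"
proof -
  have PD: "orth_proj S D \<in> symmat" using orth_proj_in[OF D] sym by blast
  note tr = trace_inner_eq_inner[OF D] trace_inner_eq_inner[OF PD]
  have X: "X \<in> orth_proj S ` ((+) B ` M)" "X \<in> psd" "X \<in> S"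
    and le: "\<And>Z. Z \<in> orth_proj S ` ((+) B ` M) \<Longrightarrow> Z \<in> psd \<Longrightarrow> Z \<in> S
      \<Longrightarrow> orth_proj S D \<bullet> X \<le> orth_proj S D \<bullet> Z"
    using min by (simp_all add: is_arg_min_linorder orth_proj_image_affine tr)
  have "D \<bullet> X \<le> D \<bullet> Z" if Z: "Z \<in> (+) B ` M" "Z \<in> psd" for Z
  proof -
    have Zs: "Z \<in> symmat" using Z psd_subset_symmat by blast
    have PZ: "orth_proj S Z \<in> S" "orth_proj S Z \<in> psd"
      using orth_proj_in[OF Zs] psd Z by auto
    \<comment> \<open>This term and the next add up to
      \<open>D \<bullet> (Z - orth_proj S Z)\<close>; the second vanishes because
      \<open>Z - orth_proj S Z\<close> is orthogonal to \<open>S\<close>.\<close>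
    have "(D - orth_proj S D) \<bullet> (Z - orth_proj S Z) = 0"
      using perp orth_proj_diff_mem[OF Z(1)] .
    moreover have "orth_proj S D \<bullet> (Z - orth_proj S Z) = 0"
      using orth_proj_inner[OF Zs orth_proj_in[OF D]]
      by (simp add: inner_diff_right inner_commute)
    moreover have "D \<bullet> X = orth_proj S D \<bullet> X"
      using orth_proj_inner[OF D X(3)] by simp
    moreover have "orth_proj S D \<bullet> orth_proj S Z = D \<bullet> orth_proj S Z"
      using orth_proj_inner[OF D PZ(1)] .
    moreover have "orth_proj S D \<bullet> X \<le> orth_proj S D \<bullet> orth_proj S Z"
      using le PZ Z by blast
    ultimately show ?thesis by (simp add: inner_diff_left inner_diff_right)
  qed
  then show ?thesis using X inv by (auto simp: is_arg_min_linorder tr)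
qed

end

end

text \<open>The optimal value of the first problem bounds every feasible value of the second from
  below, and \<open>y\<close> does not exceed it.\<close>

lemma is_arg_min_transfer:
  fixes f :: "'a \<Rightarrow> 'c::linorder"
  assumes "is_arg_min f P x" and "Q y" and "g y \<le> f x"
    and "\<And>z. Q z \<Longrightarrow> \<exists>w. P w \<and> f w \<le> g z"
  shows "is_arg_min g Q y"
  using assms unfolding is_arg_min_linorder by (meson order_trans)

lemma is_arg_max_uminus:
  fixes f :: "'a \<Rightarrow> 'c::linordered_idom"
  shows "is_arg_max (\<lambda>x. - f x) P x \<longleftrightarrow> is_arg_min f P x"
  by (simp add: is_arg_max_def is_arg_min_def)

theorem proposition2p6:
  fixes L S :: "(real^'n^'n) set"
    and C Y :: "real^'n^'n"
    and \<Psi> :: "'v::real_inner \<Rightarrow> real^'n^'n"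
    and K :: "'v set"
    and Xhat Shat :: 'v
  assumes "subspace L" and "L \<subseteq> symmat"
    and "C \<in> symmat" and "Y \<in> symmat"
    and "subspace S" and "S \<subseteq> symmat"
    and "constraint_set_invariance (orth_proj S) C Y L"
    and "linear \<Psi>" and "inj \<Psi>" and "range \<Psi> = S"
    and "self_dual_cone K" and "\<Psi> ` K = psd \<inter> S"
    and "is_arg_min (\<lambda>X. adjoint \<Psi> C \<bullet> X)
           (\<lambda>X. X \<in> (inv (adjoint \<Psi> \<circ> \<Psi>) \<circ> adjoint \<Psi>) ` ((+) Y ` L) \<and> X \<in> K) Xhat"
    and "is_arg_max (\<lambda>Z. - (inv (adjoint \<Psi> \<circ> \<Psi>) (adjoint \<Psi> Y) \<bullet> Z))
           (\<lambda>Z. Z \<in> adjoint \<Psi> ` ((+) C ` sym_perp L) \<and> Z \<in> K) Shat"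
  shows "is_arg_min (\<lambda>X. orth_proj S C \<odot> X)
           (\<lambda>X. X \<in> (+) (orth_proj S Y) ` (L \<inter> S) \<and> X \<in> psd \<inter> S) (\<Psi> Xhat)
       \<and> is_arg_max (\<lambda>Z. - (orth_proj S Y \<odot> Z))
           (\<lambda>Z. Z \<in> (+) (orth_proj S C) ` (sym_perp L \<inter> S) \<and> Z \<in> psd \<inter> S)
           (\<Psi> (inv (adjoint \<Psi> \<circ> \<Psi>) Shat))
       \<and> is_arg_min (\<lambda>X. C \<odot> X) (\<lambda>X. X \<in> (+) Y ` L \<and> X \<in> psd) (\<Psi> Xhat)
       \<and> is_arg_max (\<lambda>Z. - (Y \<odot> Z)) (\<lambda>Z. Z \<in> (+) C ` sym_perp L \<and> Z \<in> psd)
           (\<Psi> (inv (adjoint \<Psi> \<circ> \<Psi>) Shat))"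
proof -
  define P where "P = orth_proj S"
  define A where "A = adjoint \<Psi>"
  define G where "G = A \<circ> \<Psi>"
  note sub = assms(5) and sym = assms(6) and Ysym = assms(4) and Csym = assms(3)
  have psdP: "P ` psd \<subseteq> psd" and invY: "P ` ((+) Y ` L) \<subseteq> (+) Y ` L"
    and invC: "P ` ((+) C ` sym_perp L) \<subseteq> (+) C ` sym_perp L"
    using assms(7) by (auto simp: constraint_set_invariance_def P_def)
  have perp_sym: "sym_perp L \<subseteq> symmat" by (auto simp: sym_perp_def)
  have S\<Psi>: "\<Psi> v \<in> S" for v using assms(10) by blast
  have adj: "v \<bullet> A X = \<Psi> v \<bullet> X" for v X
    unfolding A_def using adjoint_inj_works[OF assms(8,9)] by metis
  have AP: "A X = A (P X)" if X: "X \<in> symmat" for X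
  proof -
    have "v \<bullet> A X = v \<bullet> A (P X)" for v
      using orth_proj_inner[OF sub sym X S\<Psi>, of v] by (simp add: adj P_def inner_commute)
    then show ?thesis by (metis vector_eq_ldot)
  qed
  have "inj G"
  proof (rule injI)
    fix v w assume "G v = G w"
    \<comment> \<open>Pairing \<open>G v - G w\<close> with \<open>v - w\<close> gives the squared
      norm of \<open>\<Psi> v - \<Psi> w\<close>. Injectivity makes \<open>inv G\<close> a left
      inverse of \<open>G\<close>, and it is applied only to values of \<open>G\<close>.\<close>
    then have "(v - w) \<bullet> A (\<Psi> v) = (v - w) \<bullet> A (\<Psi> w)" by (simp add: G_def)
    then have "(\<Psi> v - \<Psi> w) \<bullet> (\<Psi> v - \<Psi> w) = 0"
      by (simp add: adj linear_diff[OF assms(8)] inner_diff_right)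
    then show "v = w" using assms(9) by (simp add: inj_eq)
  qed
  then have invG: "inv G (A (\<Psi> v)) = v" for v
    using inv_f_f[of G v] by (simp add: G_def)
  have \<Psi>inv: "\<Psi> (inv G (A X)) = P X" if X: "X \<in> symmat" for X
  proof -
    obtain v where v: "P X = \<Psi> v"
      using orth_proj_in[OF sub sym X] assms(10) by (auto simp: P_def)
    then show ?thesis by (simp add: AP[OF X] invG)
  qed
  have Kiff: "v \<in> K \<longleftrightarrow> \<Psi> v \<in> psd" for v
    using assms(12) S\<Psi>[of v] assms(9) by (metis IntD1 IntI image_iff inj_eq)
  have AKiff: "A (\<Psi> v) \<in> K \<longleftrightarrow> \<Psi> v \<in> psd" for v
  proof -
    have "A (\<Psi> v) \<in> K \<longleftrightarrow> (\<forall>c\<in>K. 0 \<le> A (\<Psi> v) \<bullet> c)"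
      using assms(11) unfolding self_dual_cone_def by blast
    also have "\<dots> \<longleftrightarrow> (\<forall>Z\<in>\<Psi> ` K. 0 \<le> \<Psi> v \<bullet> Z)"
      by (simp add: adj inner_commute)
    also have "\<dots> \<longleftrightarrow> (\<forall>Z\<in>psd. 0 \<le> \<Psi> v \<bullet> Z)"
    proof
      assume nonneg: "\<forall>Z\<in>\<Psi> ` K. 0 \<le> \<Psi> v \<bullet> Z"
      show "\<forall>Z\<in>psd. 0 \<le> \<Psi> v \<bullet> Z"
      proof
        fix Z :: "real^'n^'n" assume Z: "Z \<in> psd"
        then have Zs: "Z \<in> symmat" using psd_subset_symmat by blast
        have "P Z \<in> \<Psi> ` K"
          using Z Zs psdP orth_proj_in[OF sub sym Zs] by (auto simp: P_def assms(12))
        then have "0 \<le> \<Psi> v \<bullet> P Z" using nonneg by blast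
        then show "0 \<le> \<Psi> v \<bullet> Z"
          using orth_proj_inner[OF sub sym Zs S\<Psi>, of v] by (simp add: P_def inner_commute)
      qed
    qed (auto simp: assms(12))
    also have "\<dots> \<longleftrightarrow> \<Psi> v \<in> psd"
      using psd_iff_inner_nonneg S\<Psi> sym by blast
    finally show ?thesis .
  qed

  \<comment> \<open>Constraint sets and objectives carried from \<open>\<V>\<close> to
    \<open>S\<close>\<close>
  have affY: "P ` ((+) Y ` L) = (+) (P Y) ` (L \<inter> S)"
    using orth_proj_image_affine[OF sub sym assms(1,2) Ysym] invY by (simp add: P_def)
  have affC: "P ` ((+) C ` sym_perp L) = (+) (P C) ` (sym_perp L \<inter> S)"
    using orth_proj_image_affine[OF sub sym subspace_sym_perp perp_sym Csym] invC
    by (simp add: P_def)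
  have symY: "(+) Y ` L \<subseteq> symmat" and symC: "(+) C ` sym_perp L \<subseteq> symmat"
    using Ysym Csym assms(2) perp_sym subspace_add[OF subspace_symmat] by auto
  have PY: "P Y \<in> S" and PC: "P C \<in> S"
    using orth_proj_in[OF sub sym] Ysym Csym by (auto simp: P_def)
  have trP: "P Y \<odot> X = P Y \<bullet> X" "P C \<odot> X = P C \<bullet> X" for X
    using PY PC sym by (auto simp: trace_inner_eq_inner)
  have primal_obj: "A C \<bullet> v = P C \<odot> \<Psi> v" for v
    using orth_proj_inner[OF sub sym Csym S\<Psi>, of v]
    by (simp add: trP) (simp add: P_def adj inner_commute[of "A C"] inner_commute[of C])
  \<comment> \<open>Moving \<open>A\<close> across the inner product turns
    \<open>inv G (A Y)\<close> into \<open>\<Psi> (inv G (A Y)) = P Y\<close>.\<close>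
  have dual_obj: "inv G (A Y) \<bullet> A (\<Psi> w) = P Y \<odot> \<Psi> w" for w
    by (simp add: adj \<Psi>inv[OF Ysym] trP)
  have primal: "X \<in> (inv G \<circ> A) ` ((+) Y ` L) \<longleftrightarrow> \<Psi> X \<in> (+) (P Y) ` (L \<inter> S)" for X
  proof -
    have "X = inv G (A Z) \<longleftrightarrow> \<Psi> X = P Z" if "Z \<in> (+) Y ` L" for Z
      using \<Psi>inv[of Z] that symY assms(9) by (metis inj_eq subsetD)
    then show ?thesis unfolding affY[symmetric] by (simp add: image_iff)
  qed
  \<comment> \<open>Dual points correspond to \<open>S\<close> through
    \<open>w \<mapsto> A (\<Psi> w) = G w\<close>, which explains the \<open>inv G\<close> in the
    recovered dual solution.\<close>
  have dual: "Z \<in> A ` ((+) C ` sym_perp L) \<longleftrightarrow>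
      (\<exists>w. Z = A (\<Psi> w) \<and> \<Psi> w \<in> (+) (P C) ` (sym_perp L \<inter> S))" for Z
  proof -
    have "Z \<in> A ` ((+) C ` sym_perp L) \<longleftrightarrow> Z \<in> A ` P ` ((+) C ` sym_perp L)"
      using symC AP by (metis (no_types, lifting) image_cong image_image subsetD)
    also have "\<dots> \<longleftrightarrow> (\<exists>X\<in>S. Z = A X \<and> X \<in> (+) (P C) ` (sym_perp L \<inter> S))"
      using PC subspace_add[OF sub] by (auto simp: affC)
    finally show ?thesis unfolding assms(10)[symmetric] by blast
  qed

  \<comment> \<open>Optimality for the pair restricted to \<open>S\<close>\<close>
  have min1: "is_arg_min (\<lambda>X. P C \<odot> X)
      (\<lambda>X. X \<in> (+) (P Y) ` (L \<inter> S) \<and> X \<in> psd \<inter> S) (\<Psi> Xhat)"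
  proof (rule is_arg_min_transfer)
    show opt: "is_arg_min (\<lambda>X. A C \<bullet> X) (\<lambda>X. X \<in> (inv G \<circ> A) ` ((+) Y ` L) \<and> X \<in> K) Xhat"
      using assms(13) by (simp only: A_def G_def)
    show "\<Psi> Xhat \<in> (+) (P Y) ` (L \<inter> S) \<and> \<Psi> Xhat \<in> psd \<inter> S"
      using opt unfolding is_arg_min_def primal Kiff by (simp add: S\<Psi>)
    show "P C \<odot> \<Psi> Xhat \<le> A C \<bullet> Xhat" by (simp add: primal_obj)
    fix Z assume Z: "Z \<in> (+) (P Y) ` (L \<inter> S) \<and> Z \<in> psd \<inter> S"
    then obtain w where "Z = \<Psi> w" using assms(10) by blast
    then show "\<exists>w. (w \<in> (inv G \<circ> A) ` ((+) Y ` L) \<and> w \<in> K) \<and> A C \<bullet> w \<le> P C \<odot> Z"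
      using Z unfolding primal Kiff by (auto simp: primal_obj)
  qed
  have min2: "is_arg_min (\<lambda>Z. P Y \<odot> Z)
      (\<lambda>Z. Z \<in> (+) (P C) ` (sym_perp L \<inter> S) \<and> Z \<in> psd \<inter> S) (\<Psi> (inv G Shat))"
  proof (rule is_arg_min_transfer)
    show opt: "is_arg_min (\<lambda>Z. inv G (A Y) \<bullet> Z)
        (\<lambda>Z. Z \<in> A ` ((+) C ` sym_perp L) \<and> Z \<in> K) Shat"
      using assms(14) unfolding is_arg_max_uminus by (simp only: A_def G_def)
    obtain w where w: "Shat = A (\<Psi> w)" "\<Psi> w \<in> (+) (P C) ` (sym_perp L \<inter> S)" "Shat \<in> K"
      using opt unfolding is_arg_min_def dual by blast
    show "\<Psi> (inv G Shat) \<in> (+) (P C) ` (sym_perp L \<inter> S) \<and> \<Psi> (inv G Shat) \<in> psd \<inter> S"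
      using w AKiff by (simp add: invG S\<Psi>)
    show "P Y \<odot> \<Psi> (inv G Shat) \<le> inv G (A Y) \<bullet> Shat"
      by (simp add: w(1) invG dual_obj)
    fix Z assume Z: "Z \<in> (+) (P C) ` (sym_perp L \<inter> S) \<and> Z \<in> psd \<inter> S"
    then obtain z where z: "Z = \<Psi> z" using assms(10) by blast
    \<comment> \<open>\<open>A Z\<close> is the competitor in \<open>\<V>\<close> corresponding to
      \<open>Z\<close>.\<close>
    have "A Z \<in> A ` ((+) C ` sym_perp L) \<and> A Z \<in> K"
      using Z unfolding z AKiff dual by blast
    moreover have "inv G (A Y) \<bullet> A Z \<le> P Y \<odot> Z" by (simp add: z dual_obj)
    ultimately show "\<exists>w. (w \<in> A ` ((+) C ` sym_perp L) \<and> w \<in> K) \<and> inv G (A Y) \<bullet> w \<le> P Y \<odot> Z"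
      by blast
  qed

  \<comment> \<open>Optimality for the original pair\<close>
  have PCperp: "C - P C \<in> sym_perp L"
    unfolding P_def
    using orth_proj_diff_mem[OF sub sym subspace_sym_perp perp_sym Csym, of C] invC
      subspace_0[OF subspace_sym_perp, of L] by (force simp: P_def)
  have PYL: "Y - P Y \<in> L"
    unfolding P_def
    using orth_proj_diff_mem[OF sub sym assms(1,2) Ysym, of Y] invY
      subspace_0[OF assms(1)] by (force simp: P_def)
  have perp: "m \<bullet> l = 0" if "m \<in> sym_perp L" "l \<in> L" for m l
    using that by (auto simp: sym_perp_def trace_inner_eq_inner)
  have min3: "is_arg_min (\<lambda>X. C \<odot> X) (\<lambda>X. X \<in> (+) Y ` L \<and> X \<in> psd) (\<Psi> Xhat)"
    using psdP invY Csym PCperp perp min1 unfolding P_def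
    by (intro restricted_arg_min_imp_arg_min[OF sub sym assms(1,2) Ysym]) auto
  \<comment> \<open>The roles are exchanged: the cost is now \<open>Y\<close>, the affine set is
    \<open>C + sym_perp L\<close>, and orthogonality comes from
    \<open>Y - P Y \<in> L\<close>.\<close>
  have min4: "is_arg_min (\<lambda>Z. Y \<odot> Z) (\<lambda>Z. Z \<in> (+) C ` sym_perp L \<and> Z \<in> psd) (\<Psi> (inv G Shat))"
    using psdP invC Ysym PYL perp min2 unfolding P_def
    by (intro restricted_arg_min_imp_arg_min[OF sub sym subspace_sym_perp perp_sym Csym])
      (auto simp: inner_commute)
  show ?thesis
    using min1 min2 min3 min4 unfolding is_arg_max_uminus by (simp only: P_def A_def G_def)
qed

end
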